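(* Let $\hat\sigma(T,K;\overline p)$ be a parametrized implied volatility function with parameter domain $\mathcal D\subset\mathbb R^m$ such that for every $\overline p\in\mathcal D$ the surface $(T,K)\mapsto\hat\sigma(T,K;\overline p)$ is arbitrage-free. Let $1\le i\le m$, let $\vartheta$ be a real-valued random variable on a probability space $(\Omega,\mathcal F,\mathbb P)$ with law $\mu$, and let $\overline p(\vartheta)=(p_1,\dots,p_{i-1},\vartheta,p_{i+1},\dots,p_m)$ be the random vector obtained from $\overline p=(p_1,\dots,p_m)$ by replacing its $i$-th entry by $\vartheta$. Assume that $\overline p(\vartheta)\in\mathcal D$ almost surely and that $\theta\mapsto\hat\sigma(T,K;\overline p(\theta))$ is measurable for every $(T,K)\in\Pi$. Then the map $\hat\sigma(T,K)$ on $\Pi$ determined by $$BS_{c/p}\bigl(t_0,S_0,T,K;\hat\sigma(T,K)\bigr)=\mathbb E\bigl[V_{c/p}(T,K;\overline p(\vartheta))\bigr]\qquad\text{for all }(T,K)\in\Pi$$ is an arbitrage-free implied volatility surface.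
   Context: Fix a time $t_0$, a spot price $S_0>0$ and a constant risk-free rate $r$. Let $\Pi=\Pi_T\times\Pi_K=(t_0,\infty)\times(0,\infty)$. $BS_c(t_0,S_0,T,K;\sigma)$ and $BS_p(t_0,S_0,T,K;\sigma)$ denote the Black-Scholes prices at time $t_0$ of European call and put options with expiry $T$, strike $K$, spot $S_0$, rate $r$ and volatility $\sigma\ge 0$ (for $\sigma=0$: the limiting value as $\sigma\downarrow 0$). The subscript $c/p$ means that a formula holds for both calls and puts. A parametrized implied volatility function with parameter domain $\mathcal D\subset\mathbb R^m$ is a map $\hat\sigma(T,K;\overline p)\ge 0$, defined for $(T,K)\in\Pi$ and $\overline p\in\mathcal D$, which for each fixed $\overline p$ is of class $C^{1,2}$ in $(T,K)$. Its pricing functions are $V_{c/p}(T,K;\overline p):=BS_{c/p}(t_0,S_0,T,K;\hat\sigma(T,K;\overline p))$. Arbitrage-free: a volatility surface $\hat\sigma(T,K)$ on $\Pi$ with call pricing function $V_c(T,K)=BS_c(t_0,S_0,T,K;\hat\sigma(T,K))$, extended to $T=t_0$ by its limit as $T\downarrow t_0$, is called arbitrage-free if for some constant $s>0$: (i) $V_c(T,\cdot)$ is convex and non-increasing for all $T\in\Pi_T$; (ii) $\lim_{K\to\infty}V_c(T,K)=0$ for all $T\in\Pi_T$; (iii) $(s-K)^+\le V_c(T,K)\le s$ for all $(T,K)\in\Pi$; (iv) $V_c(t_0,K)=(s-K)^+$ for all $K\in\Pi_K$; (v) $V_c(\cdot,K)$ is non-decreasing for all $K\in\Pi_K$. (Conditions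 (i)-(iv) are absence of butterfly arbitrage, (v) is absence of calendar arbitrage.) *)

theory Defs
  imports "HOL-Probability.Probability"
begin

definition bs_d1 :: "real \<Rightarrow> real \<Rightarrow> real \<Rightarrow> real \<Rightarrow> real \<Rightarrow> real \<Rightarrow> real" where
  "bs_d1 t\<^sub>0 S\<^sub>0 r T K \<sigma> =
     (ln (S\<^sub>0 / K) + (r + \<sigma>\<^sup>2 / 2) * (T - t\<^sub>0)) / (\<sigma> * sqrt (T - t\<^sub>0))"

definition bs_d2 :: "real \<Rightarrow> real \<Rightarrow> real \<Rightarrow> real \<Rightarrow> real \<Rightarrow> real \<Rightarrow> real" where
  "bs_d2 t\<^sub>0 S\<^sub>0 r T K \<sigma> = bs_d1 t\<^sub>0 S\<^sub>0 r T K \<sigma> - \<sigma> * sqrt (T - t\<^sub>0)"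

definition bs_call_formula :: "real \<Rightarrow> real \<Rightarrow> real \<Rightarrow> real \<Rightarrow> real \<Rightarrow> real \<Rightarrow> real" where
  "bs_call_formula t\<^sub>0 S\<^sub>0 r T K \<sigma> =
     S\<^sub>0 * cdf std_normal_distribution (bs_d1 t\<^sub>0 S\<^sub>0 r T K \<sigma>)
     - K * exp (- r * (T - t\<^sub>0)) * cdf std_normal_distribution (bs_d2 t\<^sub>0 S\<^sub>0 r T K \<sigma>)"

definition bs_put_formula :: "real \<Rightarrow> real \<Rightarrow> real \<Rightarrow> real \<Rightarrow> real \<Rightarrow> real \<Rightarrow> real" where
  "bs_put_formula t\<^sub>0 S\<^sub>0 r T K \<sigma> =
     K * exp (- r * (T - t\<^sub>0)) * cdf std_normal_distribution (- bs_d2 t\<^sub>0 S\<^sub>0 r T K \<sigma>)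
     - S\<^sub>0 * cdf std_normal_distribution (- bs_d1 t\<^sub>0 S\<^sub>0 r T K \<sigma>)"

text \<open>At zero volatility the closed formula divides by zero; the price is the limit there.\<close>

definition BS_call :: "real \<Rightarrow> real \<Rightarrow> real \<Rightarrow> real \<Rightarrow> real \<Rightarrow> real \<Rightarrow> real" where
  "BS_call t\<^sub>0 S\<^sub>0 r T K \<sigma> =
     (if \<sigma> = 0 then Lim (at_right 0) (bs_call_formula t\<^sub>0 S\<^sub>0 r T K)
      else bs_call_formula t\<^sub>0 S\<^sub>0 r T K \<sigma>)"

definition BS_put :: "real \<Rightarrow> real \<Rightarrow> real \<Rightarrow> real \<Rightarrow> real \<Rightarrow> real \<Rightarrow> real" where
  "BS_put t\<^sub>0 S\<^sub>0 r T K \<sigma> =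
     (if \<sigma> = 0 then Lim (at_right 0) (bs_put_formula t\<^sub>0 S\<^sub>0 r T K)
      else bs_put_formula t\<^sub>0 S\<^sub>0 r T K \<sigma>)"

definition C12_on :: "real set \<Rightarrow> real set \<Rightarrow> (real \<Rightarrow> real \<Rightarrow> real) \<Rightarrow> bool" where
  "C12_on A B f \<longleftrightarrow>
     (\<exists>f\<^sub>T f\<^sub>K f\<^sub>K\<^sub>K.
        (\<forall>T\<in>A. \<forall>K\<in>B.
           ((\<lambda>t. f t K) has_real_derivative f\<^sub>T T K) (at T) \<and>
           ((\<lambda>k. f T k) has_real_derivative f\<^sub>K T K) (at K) \<and>
           ((\<lambda>k. f\<^sub>K T k) has_real_derivative f\<^sub>K\<^sub>K T K) (at K)) \<and>
        continuous_on (A \<times> B) (\<lambda>(T, K). f T K) \<and>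
        continuous_on (A \<times> B) (\<lambda>(T, K). f\<^sub>T T K) \<and>
        continuous_on (A \<times> B) (\<lambda>(T, K). f\<^sub>K T K) \<and>
        continuous_on (A \<times> B) (\<lambda>(T, K). f\<^sub>K\<^sub>K T K))"

definition vol_surface :: "real \<Rightarrow> (real \<Rightarrow> real \<Rightarrow> real) \<Rightarrow> bool" where
  "vol_surface t\<^sub>0 \<sigma> \<longleftrightarrow> (\<forall>T>t\<^sub>0. \<forall>K>0. 0 \<le> \<sigma> T K)"

definition parametrized_vol ::
    "real \<Rightarrow> (real ^ 'm::finite) set \<Rightarrow> (real \<Rightarrow> real \<Rightarrow> real ^ 'm \<Rightarrow> real) \<Rightarrow> bool" where
  "parametrized_vol t\<^sub>0 D \<sigma> \<longleftrightarrow>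
     (\<forall>p\<in>D. vol_surface t\<^sub>0 (\<lambda>T K. \<sigma> T K p) \<and> C12_on {t\<^sub>0<..} {0<..} (\<lambda>T K. \<sigma> T K p))"

definition V_call :: "real \<Rightarrow> real \<Rightarrow> real \<Rightarrow> (real \<Rightarrow> real \<Rightarrow> 'p \<Rightarrow> real) \<Rightarrow> real \<Rightarrow> real \<Rightarrow> 'p \<Rightarrow> real" where
  "V_call t\<^sub>0 S\<^sub>0 r \<sigma> T K p = BS_call t\<^sub>0 S\<^sub>0 r T K (\<sigma> T K p)"

definition V_put :: "real \<Rightarrow> real \<Rightarrow> real \<Rightarrow> (real \<Rightarrow> real \<Rightarrow> 'p \<Rightarrow> real) \<Rightarrow> real \<Rightarrow> real \<Rightarrow> 'p \<Rightarrow> real" where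
  "V_put t\<^sub>0 S\<^sub>0 r \<sigma> T K p = BS_put t\<^sub>0 S\<^sub>0 r T K (\<sigma> T K p)"

text \<open>
  \<open>V\<close> is the call price function of \<open>\<sigma>\<close>, extended to \<open>T = t\<^sub>0\<close> by its limit (whose existence
  is part of the requirement). It is unique on \<open>T \<ge> t\<^sub>0\<close>, \<open>K > 0\<close>.
\<close>

definition extended_call_prices ::
    "real \<Rightarrow> real \<Rightarrow> real \<Rightarrow> (real \<Rightarrow> real \<Rightarrow> real) \<Rightarrow> (real \<Rightarrow> real \<Rightarrow> real) \<Rightarrow> bool" where
  "extended_call_prices t\<^sub>0 S\<^sub>0 r \<sigma> V \<longleftrightarrow>
     (\<forall>T>t\<^sub>0. \<forall>K>0. V T K = BS_call t\<^sub>0 S\<^sub>0 r T K (\<sigma> T K)) \<and>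
     (\<forall>K>0. ((\<lambda>T. V T K) \<longlongrightarrow> V t\<^sub>0 K) (at_right t\<^sub>0))"

definition arbitrage_free ::
    "real \<Rightarrow> real \<Rightarrow> real \<Rightarrow> (real \<Rightarrow> real \<Rightarrow> real) \<Rightarrow> bool" where
  "arbitrage_free t\<^sub>0 S\<^sub>0 r \<sigma> \<longleftrightarrow>
     (\<exists>V. extended_call_prices t\<^sub>0 S\<^sub>0 r \<sigma> V \<and>
       (\<exists>s>0.
         (\<forall>T>t\<^sub>0. convex_on {0<..} (V T) \<and> antimono_on {0<..} (V T)) \<and>
         (\<forall>T>t\<^sub>0. (V T \<longlongrightarrow> 0) at_top) \<and>
         (\<forall>T>t\<^sub>0. \<forall>K>0. max 0 (s - K) \<le> V T K \<and> V T K \<le> s) \<and>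
         (\<forall>K>0. V t\<^sub>0 K = max 0 (s - K)) \<and>
         (\<forall>K>0. mono_on {t\<^sub>0..} (\<lambda>T. V T K))))"

definition replace_entry :: "real ^ 'm::finite \<Rightarrow> 'm \<Rightarrow> real \<Rightarrow> real ^ 'm" where
  "replace_entry p i \<theta> = (\<chi> j. if j = i then \<theta> else p $ j)"

text \<open>
  Expectation of a random variable \<open>X\<close> that is only defined on an almost sure set \<open>A\<close>. As \<open>A\<close> need
  not itself be an event, the completed measure is used; values of \<open>X\<close> outside \<open>A\<close> are ignored.
\<close>

definition as_integrable :: "'w measure \<Rightarrow> 'w set \<Rightarrow> ('w \<Rightarrow> real) \<Rightarrow> bool" where
  "as_integrable M A X \<longleftrightarrow> set_integrable (completion M) A X"

definition as_expectation :: "'w measure \<Rightarrow> 'w set \<Rightarrow> ('w \<Rightarrow> real) \<Rightarrow> real" where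
  "as_expectation M A X = (LINT \<omega>:A|completion M. X \<omega>)"

text \<open>
  \<open>\<sigma>'\<close> reproduces the call and put prices of \<open>\<sigma>\<close> averaged over the random parameter \<open>P\<close>,
  which lies in \<open>D\<close> almost surely.
\<close>

definition mixture_vol ::
    "real \<Rightarrow> real \<Rightarrow> real \<Rightarrow> 'p set \<Rightarrow> (real \<Rightarrow> real \<Rightarrow> 'p \<Rightarrow> real) \<Rightarrow> 'w measure \<Rightarrow> ('w \<Rightarrow> 'p)
      \<Rightarrow> (real \<Rightarrow> real \<Rightarrow> real) \<Rightarrow> bool" where
  "mixture_vol t\<^sub>0 S\<^sub>0 r D \<sigma> M P \<sigma>' \<longleftrightarrow>
     (\<forall>T>t\<^sub>0. \<forall>K>0.
        BS_call t\<^sub>0 S\<^sub>0 r T K (\<sigma>' T K) =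
          as_expectation M {\<omega> \<in> space M. P \<omega> \<in> D} (\<lambda>\<omega>. V_call t\<^sub>0 S\<^sub>0 r \<sigma> T K (P \<omega>)) \<and>
        BS_put t\<^sub>0 S\<^sub>0 r T K (\<sigma>' T K) =
          as_expectation M {\<omega> \<in> space M. P \<omega> \<in> D} (\<lambda>\<omega>. V_put t\<^sub>0 S\<^sub>0 r \<sigma> T K (P \<omega>)))"

end

theory Submission imports Defs begin

text \<open>
  The Black-Scholes call price is a strictly increasing bijection from volatilities \<open>\<sigma> \<ge> 0\<close> onto the
  half-open interval from the discounted intrinsic value to \<open>S\<^sub>0\<close>. Averages of prices stay in this
  interval, so they have a unique implied volatility, and put-call parity makes the same volatility
  reproduce the averaged puts. The shape conditions are linear inequalities and limits of prices
  bounded by \<open>S\<^sub>0\<close>; they survive averaging by monotonicity of the integral and dominated convergence.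
\<close>

section \<open>The standard normal distribution function\<close>

abbreviation std_normal_cdf :: "real \<Rightarrow> real" where
  "std_normal_cdf \<equiv> cdf std_normal_distribution"

text \<open>Differences of the distribution function are integrals of the density, so the
  fundamental theorem of calculus applies once a finite base point is fixed. The base
  \<open>x - 1\<close> puts \<open>x\<close> in the interior of the interval, which turns the
  one-interval derivative into a full one.\<close>

lemma DERIV_std_normal_cdf:
  "(std_normal_cdf has_real_derivative std_normal_density x) (at x)"
proof -
  interpret real_distribution std_normal_distribution
    by (rule real_dist_normal_dist)
  have cont: "continuous_on A std_normal_density" for A
    unfolding normal_density_def by (auto intro!: continuous_intros)
  have eq: "std_normal_cdf y = std_normal_cdf (x - 1) + integral {x - 1..y} std_normal_density"
    if "x - 1 < y" for y
  proof -
    have int: "set_integrable lborel {x - 1..y} std_normal_density"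
      by (intro borel_integrable_atLeastAtMost' cont)
    have int': "set_integrable lborel {x - 1<..y} std_normal_density"
      by (rule set_integrable_subset[OF int]) auto
    have "std_normal_cdf y - std_normal_cdf (x - 1) = measure std_normal_distribution {x - 1<..y}"
      using that by (rule cdf_diff_eq)
    also have "\<dots> = (LINT z:{x - 1<..y}|lborel. std_normal_density z)"
      unfolding measure_def set_lebesgue_integral_def
      using int'
      by (subst emeasure_density)
        (auto simp: set_integrable_def ennreal_indicator[symmetric] ennreal_mult'[symmetric] mult.commute
          intro!: enn2real_nn_integral_eq_integral)
    also have "\<dots> = (LINT z:{x - 1..y}|lborel. std_normal_density z)"
      by (rule set_integral_cong_set)
        (auto simp: set_borel_measurable_def intro!: AE_I[where N="{x - 1}"])
    also have "\<dots> = integral {x - 1..y} std_normal_density"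
      by (rule set_borel_integral_eq_integral(2)[OF int])
    finally show ?thesis by simp
  qed
  have "((\<lambda>y. integral {x - 1..y} std_normal_density) has_real_derivative std_normal_density x)
          (at x within {x - 1..x + 1})"
    by (rule integral_has_real_derivative[OF cont]) auto
  then have "((\<lambda>y. integral {x - 1..y} std_normal_density) has_real_derivative std_normal_density x) (at x)"
    by (subst (asm) at_within_Icc_at) auto
  then have "((\<lambda>y. std_normal_cdf (x - 1) + integral {x - 1..y} std_normal_density)
      has_real_derivative std_normal_density x) (at x)"
    by (auto intro!: derivative_eq_intros)
  then show ?thesis
    by (rule has_field_derivative_transform_within_open[where S="{x - 1<..}"]) (auto simp: eq)
qed

lemma isCont_std_normal_cdf: "isCont std_normal_cdf x"
  using DERIV_std_normal_cdf by (rule DERIV_isCont)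

lemmas tendsto_std_normal_cdf [tendsto_intros] = isCont_tendsto_compose[OF isCont_std_normal_cdf]

lemma std_normal_cdf_at_top: "(std_normal_cdf \<longlongrightarrow> 1) at_top"
  and std_normal_cdf_at_bot: "(std_normal_cdf \<longlongrightarrow> 0) at_bot"
proof -
  interpret real_distribution std_normal_distribution
    by (rule real_dist_normal_dist)
  show "(std_normal_cdf \<longlongrightarrow> 1) at_top" "(std_normal_cdf \<longlongrightarrow> 0) at_bot"
    by (rule cdf_lim_at_top_prob cdf_lim_at_bot)+
qed

text \<open>The density is even, so \<open>std_normal_cdf x + std_normal_cdf (- x)\<close> has
  derivative zero; its limit at infinity identifies the constant. Put-call parity rests on this
  symmetry.\<close>

lemma std_normal_cdf_minus: "std_normal_cdf (- x) = 1 - std_normal_cdf x"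
proof -
  have "\<forall>x. ((\<lambda>x. std_normal_cdf x + std_normal_cdf (- x)) has_real_derivative 0) (at x)"
  proof
    fix x
    show "((\<lambda>x. std_normal_cdf x + std_normal_cdf (- x)) has_real_derivative 0) (at x)"
      using DERIV_add[OF DERIV_std_normal_cdf[of x]
          DERIV_chain2[OF DERIV_std_normal_cdf[of "- x"] DERIV_minus[OF DERIV_ident]]]
      by (simp add: normal_density_def)
  qed
  then have const: "(\<lambda>y. std_normal_cdf y + std_normal_cdf (- y)) = (\<lambda>_. std_normal_cdf x + std_normal_cdf (- x))"
    by (intro ext DERIV_isconst_all)
  have "((\<lambda>y. std_normal_cdf y + std_normal_cdf (- y)) \<longlongrightarrow> 1 + 0) at_top"
    by (intro tendsto_add std_normal_cdf_at_top
      filterlim_compose[OF std_normal_cdf_at_bot] filterlim_uminus_at_bot_at_top)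
  then have "std_normal_cdf x + std_normal_cdf (- x) = 1"
    unfolding const by (simp add: tendsto_const_iff)
  then show ?thesis by simp
qed

section \<open>The call price in terms of total volatility\<close>

text \<open>The call price as a function of the spot \<open>a\<close>, the discounted strike \<open>b\<close> and the total
  volatility \<open>v = \<sigma> * sqrt (T - t\<^sub>0)\<close>.\<close>

definition total_vol_call :: "real \<Rightarrow> real \<Rightarrow> real \<Rightarrow> real" where
  "total_vol_call a b v =
     a * std_normal_cdf (ln (a / b) / v + v / 2) - b * std_normal_cdf (ln (a / b) / v - v / 2)"

text \<open>The vega: the two terms containing the derivative of \<open>ln (a / b) / v\<close> cancel.\<close>

lemma DERIV_total_vol_call:
  assumes "a > 0" "b > 0" "v > 0"
  shows "(total_vol_call a b has_real_derivative
            a * std_normal_density (ln (a / b) / v + v / 2)) (at v)"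
proof -
  define L where "L = ln (a / b)"
  \<comment> \<open>The two arguments have sum \<open>2 * L / v\<close> and difference
    \<open>v\<close>, so their squares differ by \<open>2 * L\<close>. After exponentiation this
    gives the factor \<open>exp L\<close>, and \<open>b * exp L = a\<close>.\<close>
  have "(L / v - v / 2)\<^sup>2 = (L / v + v / 2)\<^sup>2 - 2 * L"
    using assms by (simp add: power2_eq_square field_simps)
  then have "exp (- (L / v - v / 2)\<^sup>2 / 2) = exp (- (L / v + v / 2)\<^sup>2 / 2) * exp L"
    by (simp add: exp_add[symmetric] field_simps)
  then have density: "b * std_normal_density (L / v - v / 2) = a * std_normal_density (L / v + v / 2)"
    using assms by (simp add: normal_density_def L_def field_simps)
  have "((\<lambda>v. a * std_normal_cdf (L / v + v / 2) - b * std_normal_cdf (L / v - v / 2))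
     has_real_derivative
      a * (std_normal_density (L / v + v / 2) * (- L / v\<^sup>2 + 1 / 2)) -
      b * (std_normal_density (L / v - v / 2) * (- L / v\<^sup>2 - 1 / 2))) (at v)"
    using assms
    by (auto intro!: derivative_eq_intros DERIV_chain2[OF DERIV_std_normal_cdf]
      simp: power2_eq_square)
  also have "a * (std_normal_density (L / v + v / 2) * (- L / v\<^sup>2 + 1 / 2)) -
      b * (std_normal_density (L / v - v / 2) * (- L / v\<^sup>2 - 1 / 2)) =
      a * std_normal_density (L / v + v / 2) * (- L / v\<^sup>2 + 1 / 2) -
      (b * std_normal_density (L / v - v / 2)) * (- L / v\<^sup>2 - 1 / 2)"
    by simp
  also have "\<dots> = a * std_normal_density (L / v + v / 2)"
    unfolding density by (simp add: algebra_simps)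
  finally show ?thesis
    unfolding L_def total_vol_call_def[abs_def] .
qed

lemma total_vol_call_strict_mono:
  assumes "a > 0" "b > 0" "0 < v" "v < w"
  shows "total_vol_call a b v < total_vol_call a b w"
proof (rule DERIV_pos_imp_increasing[OF \<open>v < w\<close>])
  fix u assume "v \<le> u" "u \<le> w"
  with assms have "u > 0" by simp
  with assms DERIV_total_vol_call[of a b u] normal_density_pos[of 1 0]
  show "\<exists>D. (total_vol_call a b has_real_derivative D) (at u) \<and> 0 < D"
    by (intro exI[of _ "a * std_normal_density (ln (a / b) / u + u / 2)"]) auto
qed

lemma total_vol_call_at_top:
  assumes "a > 0" "b > 0"
  shows "(total_vol_call a b \<longlongrightarrow> a) at_top"
proof -
  define L where "L = ln (a / b)"
  have lim: "((\<lambda>v. L / v) \<longlongrightarrow> 0) at_top"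
    by (intro tendsto_divide_0[OF tendsto_const] filterlim_at_top_imp_at_infinity filterlim_ident)
  have half: "filterlim (\<lambda>v::real. v / 2) at_top at_top"
    using filterlim_tendsto_pos_mult_at_top[OF tendsto_const _ filterlim_ident, of "1/2::real"]
    by simp
  have "filterlim (\<lambda>v. L / v + v / 2) at_top at_top"
    by (rule filterlim_tendsto_add_at_top[OF lim half])
  moreover have "filterlim (\<lambda>v. L / v - v / 2) at_bot at_top"
    using filterlim_tendsto_add_at_top[OF tendsto_minus[OF lim] half]
    by (simp add: filterlim_uminus_at_bot)
  ultimately have "((\<lambda>v. a * std_normal_cdf (L / v + v / 2) - b * std_normal_cdf (L / v - v / 2))
      \<longlongrightarrow> a * 1 - b * 0) at_top"
    by (intro tendsto_intros filterlim_compose[OF std_normal_cdf_at_top]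
        filterlim_compose[OF std_normal_cdf_at_bot])
  then show ?thesis unfolding L_def total_vol_call_def[abs_def] by simp
qed

text \<open>The term \<open>L / v\<close> dominates, so the sign of \<open>L\<close> decides: both
  arguments tend to plus infinity in the money and to minus infinity out of the money. At the money
  both tend to 0, and the limit vanishes because \<open>a = b\<close>.\<close>

lemma total_vol_call_at_0:
  assumes "a > 0" "b > 0"
  shows "(total_vol_call a b \<longlongrightarrow> max 0 (a - b)) (at_right 0)"
proof -
  define L where "L = ln (a / b)"
  have inv: "filterlim (\<lambda>v::real. inverse v) at_top (at_right 0)"
    by (rule filterlim_inverse_at_top_right)
  have half: "((\<lambda>v. v / 2) \<longlongrightarrow> 0) (at_right (0::real))"
   and half': "((\<lambda>v. - (v / 2)) \<longlongrightarrow> 0) (at_right (0::real))"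
    by (auto intro!: tendsto_eq_intros)
  have "((\<lambda>v. a * std_normal_cdf (L / v + v / 2) - b * std_normal_cdf (L / v - v / 2))
      \<longlongrightarrow> max 0 (a - b)) (at_right 0)"
  proof (cases L "0::real" rule: linorder_cases)
    case greater
    have L: "filterlim (\<lambda>v. L / v) at_top (at_right 0)"
      using filterlim_tendsto_pos_mult_at_top[OF tendsto_const greater inv]
      by (simp add: divide_inverse)
    have "filterlim (\<lambda>v. L / v + v / 2) at_top (at_right 0)"
      "filterlim (\<lambda>v. L / v - v / 2) at_top (at_right 0)"
      using filterlim_tendsto_add_at_top[OF half L] filterlim_tendsto_add_at_top[OF half' L]
      by (simp_all add: add.commute)
    then have "((\<lambda>v. a * std_normal_cdf (L / v + v / 2) - b * std_normal_cdf (L / v - v / 2))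
      \<longlongrightarrow> a * 1 - b * 1) (at_right 0)"
      by (intro tendsto_intros filterlim_compose[OF std_normal_cdf_at_top])
    moreover have "a > b"
      using greater assms by (simp add: L_def field_simps)
    ultimately show ?thesis by simp
  next
    case equal
    then have "a = b" using assms by (simp add: L_def field_simps)
    have "((\<lambda>v. a * std_normal_cdf (v / 2) - b * std_normal_cdf (- (v / 2)))
      \<longlongrightarrow> a * std_normal_cdf 0 - b * std_normal_cdf 0) (at_right 0)"
      by (intro tendsto_intros half half')
    with equal \<open>a = b\<close> show ?thesis by simp
  next
    case less
    have L: "filterlim (\<lambda>v. L / v) at_bot (at_right 0)"
      using filterlim_tendsto_neg_mult_at_bot[OF tendsto_const less inv]
      by (simp add: divide_inverse)
    have "filterlim (\<lambda>v. L / v + v / 2) at_bot (at_right 0)"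
      "filterlim (\<lambda>v. L / v - v / 2) at_bot (at_right 0)"
      using filterlim_tendsto_add_at_top[OF half L[unfolded filterlim_uminus_at_bot]]
        filterlim_tendsto_add_at_top[OF half' L[unfolded filterlim_uminus_at_bot]]
      by (simp_all add: filterlim_uminus_at_bot algebra_simps)
    then have "((\<lambda>v. a * std_normal_cdf (L / v + v / 2) - b * std_normal_cdf (L / v - v / 2))
      \<longlongrightarrow> a * 0 - b * 0) (at_right 0)"
      by (intro tendsto_intros filterlim_compose[OF std_normal_cdf_at_bot])
    moreover have "a < b"
      using less assms by (simp add: L_def field_simps)
    ultimately show ?thesis by simp
  qed
  then show ?thesis unfolding L_def total_vol_call_def[abs_def] .
qed

text \<open>A limit at infinity bounds a monotone function only weakly; passing through the larger
  value \<open>v + 1\<close> makes the bound strict. The lower bound below uses \<open>v / 2\<close>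
  in the same way.\<close>

lemma total_vol_call_less:
  assumes "a > 0" "b > 0" "v > 0"
  shows "total_vol_call a b v < a"
proof -
  have "total_vol_call a b v < total_vol_call a b (v + 1)"
    using assms by (intro total_vol_call_strict_mono) auto
  also have "\<dots> \<le> a"
  proof (rule tendsto_lowerbound[OF total_vol_call_at_top[OF assms(1,2)]])
    show "\<forall>\<^sub>F w in at_top. total_vol_call a b (v + 1) \<le> total_vol_call a b w"
      by (rule eventually_mono[OF eventually_gt_at_top[of "v + 1"]])
        (use assms in \<open>auto intro!: less_imp_le total_vol_call_strict_mono\<close>)
  qed simp
  finally show ?thesis .
qed

lemma total_vol_call_greater:
  assumes "a > 0" "b > 0" "v > 0"
  shows "max 0 (a - b) < total_vol_call a b v"
proof -
  have "max 0 (a - b) \<le> total_vol_call a b (v / 2)"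
    using assms
    by (intro tendsto_upperbound[OF total_vol_call_at_0] eventually_at_rightI[of 0 "v / 2"])
      (auto intro!: less_imp_le total_vol_call_strict_mono)
  also have "\<dots> < total_vol_call a b v"
    using assms by (intro total_vol_call_strict_mono) auto
  finally show ?thesis .
qed

text \<open>The two limits supply points with values on either side of \<open>x\<close>; the
  intermediate value theorem does the rest.\<close>

lemma total_vol_call_surj:
  assumes "a > 0" "b > 0" "max 0 (a - b) < x" "x < a"
  obtains v where "v > 0" "total_vol_call a b v = x"
proof -
  have "\<forall>\<^sub>F v in at_right 0. total_vol_call a b v < x \<and> 0 < v"
    using assms
    by (intro eventually_conj order_tendstoD(2)[OF total_vol_call_at_0] eventually_at_right_less) auto
  then obtain v where v: "total_vol_call a b v < x" "0 < v"
    by (auto dest: eventually_happens)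
  have "\<forall>\<^sub>F w in at_top. total_vol_call a b w > x \<and> w > v"
    using assms
    by (intro eventually_conj order_tendstoD(1)[OF total_vol_call_at_top] eventually_gt_at_top) auto
  then obtain w where w: "total_vol_call a b w > x" "v < w"
    by (auto dest: eventually_happens)
  have "\<exists>u. v \<le> u \<and> u \<le> w \<and> total_vol_call a b u = x"
    using v w assms
    by (intro IVT') (auto intro!: DERIV_isCont[OF DERIV_total_vol_call] continuous_at_imp_continuous_on)
  then obtain u where "v \<le> u" "total_vol_call a b u = x" by auto
  with v show ?thesis by (intro that) auto
qed


section \<open>Black-Scholes prices, parity and implied volatility\<close>

text \<open>Discounting the strike adds \<open>r * (T - t\<^sub>0)\<close> to the log-moneyness,
  which absorbs the drift term of \<open>bs_d1\<close>; rate and maturity then enter only through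
  the discounted strike and the total volatility.\<close>

lemma bs_call_formula_eq_total_vol_call:
  assumes "S\<^sub>0 > 0" "T > t\<^sub>0" "K > 0" "\<sigma> > 0"
  shows "bs_call_formula t\<^sub>0 S\<^sub>0 r T K \<sigma> =
           total_vol_call S\<^sub>0 (K * exp (- r * (T - t\<^sub>0))) (\<sigma> * sqrt (T - t\<^sub>0))"
proof -
  define q where "q = sqrt (T - t\<^sub>0)"
  have q: "q > 0" "T - t\<^sub>0 = q\<^sup>2"
    using assms by (auto simp: q_def)
  have ln: "ln (S\<^sub>0 / (K * exp (- (r * q\<^sup>2)))) = ln (S\<^sub>0 / K) + r * q\<^sup>2"
    using assms by (simp add: ln_div ln_mult)
  have d1: "bs_d1 t\<^sub>0 S\<^sub>0 r T K \<sigma> = ln (S\<^sub>0 / (K * exp (- (r * q\<^sup>2)))) / (\<sigma> * q) + \<sigma> * q / 2"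
    unfolding bs_d1_def q_def[symmetric] q(2) ln
    using assms q by (simp add: field_simps power2_eq_square)
  then have d2: "bs_d2 t\<^sub>0 S\<^sub>0 r T K \<sigma> = ln (S\<^sub>0 / (K * exp (- (r * q\<^sup>2)))) / (\<sigma> * q) - \<sigma> * q / 2"
    unfolding bs_d2_def q_def[symmetric] by simp
  show ?thesis
    unfolding bs_call_formula_def total_vol_call_def d1 d2 q_def[symmetric] unfolding q(2) by simp
qed

lemma tendsto_bs_call_formula_at_0:
  assumes "S\<^sub>0 > 0" "T > t\<^sub>0" "K > 0"
  shows "(bs_call_formula t\<^sub>0 S\<^sub>0 r T K \<longlongrightarrow> max 0 (S\<^sub>0 - K * exp (- r * (T - t\<^sub>0)))) (at_right 0)"
proof -
  have "filterlim (\<lambda>\<sigma>. \<sigma> * sqrt (T - t\<^sub>0)) (at_right 0) (at_right 0)"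
    using assms
    by (auto simp: filterlim_at intro!: tendsto_eq_intros eventually_at_rightI[of 0 1])
  then have "((\<lambda>\<sigma>. total_vol_call S\<^sub>0 (K * exp (- r * (T - t\<^sub>0))) (\<sigma> * sqrt (T - t\<^sub>0)))
      \<longlongrightarrow> max 0 (S\<^sub>0 - K * exp (- r * (T - t\<^sub>0)))) (at_right 0)"
    using assms by (intro filterlim_compose[OF total_vol_call_at_0]) auto
  then show ?thesis
    by (rule Lim_transform_eventually)
      (use assms in \<open>auto simp: bs_call_formula_eq_total_vol_call intro!: eventually_at_rightI[of 0 1]\<close>)
qed

text \<open>\<open>Lim\<close> is a definite description, so its value at zero volatility becomes
  usable only through the convergence just proved.\<close>

lemma BS_call_eq:
  assumes "S\<^sub>0 > 0" "T > t\<^sub>0" "K > 0" "\<sigma> \<ge> 0"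
  shows "BS_call t\<^sub>0 S\<^sub>0 r T K \<sigma> =
    (if \<sigma> = 0 then max 0 (S\<^sub>0 - K * exp (- r * (T - t\<^sub>0)))
     else total_vol_call S\<^sub>0 (K * exp (- r * (T - t\<^sub>0))) (\<sigma> * sqrt (T - t\<^sub>0)))"
  using assms(4) tendsto_Lim[OF _ tendsto_bs_call_formula_at_0[OF assms(1-3), of r]]
    bs_call_formula_eq_total_vol_call[OF assms(1-3), of \<sigma> r]
  by (simp add: BS_call_def)

lemma put_call_parity:
  assumes "S\<^sub>0 > 0" "T > t\<^sub>0" "K > 0" "\<sigma> \<ge> 0"
  shows "BS_put t\<^sub>0 S\<^sub>0 r T K \<sigma> = BS_call t\<^sub>0 S\<^sub>0 r T K \<sigma> + (K * exp (- r * (T - t\<^sub>0)) - S\<^sub>0)"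
proof -
  \<comment> \<open>An identity of functions of the volatility, valid even at 0 where division by
    zero yields a default value; hence it can be rewritten under the limit.\<close>
  have parity: "bs_put_formula t\<^sub>0 S\<^sub>0 r T K =
      (\<lambda>\<sigma>. bs_call_formula t\<^sub>0 S\<^sub>0 r T K \<sigma> + (K * exp (- r * (T - t\<^sub>0)) - S\<^sub>0))"
    by (auto simp: bs_put_formula_def bs_call_formula_def std_normal_cdf_minus algebra_simps)
  have "(bs_put_formula t\<^sub>0 S\<^sub>0 r T K \<longlongrightarrow> max 0 (S\<^sub>0 - K * exp (- r * (T - t\<^sub>0)))
      + (K * exp (- r * (T - t\<^sub>0)) - S\<^sub>0)) (at_right 0)"
    unfolding parity by (intro tendsto_add tendsto_bs_call_formula_at_0 assms tendsto_const)
  then show ?thesis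
    using tendsto_bs_call_formula_at_0[OF assms(1-3), of r]
    by (auto simp: BS_call_def BS_put_def parity tendsto_Lim)
qed

text \<open>Between positive volatilities this is positivity of vega. From volatility 0, whose price
  is a limit value, it is the strict bound \<open>total_vol_call_greater\<close>.\<close>

lemma BS_call_strict_mono_on:
  assumes "S\<^sub>0 > 0" "T > t\<^sub>0" "K > 0"
  shows "strict_mono_on {0..} (BS_call t\<^sub>0 S\<^sub>0 r T K)"
proof (rule strict_mono_onI)
  fix \<sigma> \<tau> :: real assume *: "\<sigma> \<in> {0..}" "\<tau> \<in> {0..}" "\<sigma> < \<tau>"
  with assms show "BS_call t\<^sub>0 S\<^sub>0 r T K \<sigma> < BS_call t\<^sub>0 S\<^sub>0 r T K \<tau>"
    using total_vol_call_greater[of S\<^sub>0 "K * exp (- r * (T - t\<^sub>0))" "\<tau> * sqrt (T - t\<^sub>0)"]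
    by (auto simp: BS_call_eq intro!: total_vol_call_strict_mono)
qed

text \<open>The interval is half-open because the intrinsic value is the price at volatility 0,
  whereas the spot is only approached as volatility grows.\<close>

lemma BS_call_image:
  assumes "S\<^sub>0 > 0" "T > t\<^sub>0" "K > 0"
  shows "BS_call t\<^sub>0 S\<^sub>0 r T K ` {0..} = {max 0 (S\<^sub>0 - K * exp (- r * (T - t\<^sub>0)))..<S\<^sub>0}"
proof (intro equalityI subsetI)
  fix x assume "x \<in> BS_call t\<^sub>0 S\<^sub>0 r T K ` {0..}"
  then obtain \<sigma> where "\<sigma> \<ge> 0" "x = BS_call t\<^sub>0 S\<^sub>0 r T K \<sigma>" by auto
  with assms show "x \<in> {max 0 (S\<^sub>0 - K * exp (- r * (T - t\<^sub>0)))..<S\<^sub>0}"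
    using total_vol_call_greater[of S\<^sub>0 "K * exp (- r * (T - t\<^sub>0))" "\<sigma> * sqrt (T - t\<^sub>0)"]
      total_vol_call_less[of S\<^sub>0 "K * exp (- r * (T - t\<^sub>0))" "\<sigma> * sqrt (T - t\<^sub>0)"]
    by (auto simp: BS_call_eq)
next
  fix x assume x: "x \<in> {max 0 (S\<^sub>0 - K * exp (- r * (T - t\<^sub>0)))..<S\<^sub>0}"
  show "x \<in> BS_call t\<^sub>0 S\<^sub>0 r T K ` {0..}"
  proof (cases "x = max 0 (S\<^sub>0 - K * exp (- r * (T - t\<^sub>0)))")
    case True
    with assms show ?thesis by (intro image_eqI[of _ _ 0]) (auto simp: BS_call_eq)
  next
    case False
    with x have "max 0 (S\<^sub>0 - K * exp (- r * (T - t\<^sub>0))) < x" "x < S\<^sub>0"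
      by auto
    then obtain v where "v > 0" "total_vol_call S\<^sub>0 (K * exp (- r * (T - t\<^sub>0))) v = x"
      using assms by (elim total_vol_call_surj[rotated 2]) auto
    with assms show ?thesis
      by (intro image_eqI[of _ _ "v / sqrt (T - t\<^sub>0)"]) (auto simp: BS_call_eq)
  qed
qed

text \<open>Monotone functions are Borel. Composing with \<open>max 0\<close> makes the price
  monotone on the whole line and changes nothing for nonnegative \<open>f\<close>.\<close>

lemma borel_measurable_BS_call:
  assumes "S\<^sub>0 > 0" "T > t\<^sub>0" "K > 0"
    and f: "f \<in> borel_measurable N" "\<And>\<omega>. \<omega> \<in> space N \<Longrightarrow> f \<omega> \<ge> 0"
  shows "(\<lambda>\<omega>. BS_call t\<^sub>0 S\<^sub>0 r T K (f \<omega>)) \<in> borel_measurable N"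
proof -
  have "mono (\<lambda>\<sigma>. BS_call t\<^sub>0 S\<^sub>0 r T K (max 0 \<sigma>))"
    by (intro monoI strict_mono_on_leD[OF BS_call_strict_mono_on[OF assms(1-3)]]) auto
  then have "(\<lambda>\<omega>. BS_call t\<^sub>0 S\<^sub>0 r T K (max 0 (f \<omega>))) \<in> borel_measurable N"
    by (rule measurable_compose[OF f(1) borel_measurable_mono])
  then show ?thesis
    by (rule measurable_cong[THEN iffD1, rotated]) (use f(2) in \<open>auto simp: max_def\<close>)
qed

section \<open>No-arbitrage conditions on a price function\<close>

text \<open>The existential quantifiers of \<open>arbitrage_free\<close> are gone: \<open>s\<close>
  is a parameter, and a limit replaces the extension to \<open>t\<^sub>0\<close>. Each clause
  concerns the prices alone and can be averaged.\<close>

definition no_static_arbitrage :: "real \<Rightarrow> real \<Rightarrow> (real \<Rightarrow> real \<Rightarrow> real) \<Rightarrow> bool" where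
  "no_static_arbitrage t\<^sub>0 s C \<longleftrightarrow>
     (\<forall>T>t\<^sub>0. convex_on {0<..} (C T)) \<and>
     (\<forall>T>t\<^sub>0. antimono_on {0<..} (C T)) \<and>
     (\<forall>T>t\<^sub>0. (C T \<longlongrightarrow> 0) at_top) \<and>
     (\<forall>T>t\<^sub>0. \<forall>K>0. max 0 (s - K) \<le> C T K \<and> C T K \<le> s) \<and>
     (\<forall>K>0. ((\<lambda>T. C T K) \<longlongrightarrow> max 0 (s - K)) (at_right t\<^sub>0)) \<and>
     (\<forall>K>0. mono_on {t\<^sub>0<..} (\<lambda>T. C T K))"

text \<open>Prices given by an implied volatility are prescribed only for
  \<open>T > t\<^sub>0\<close> and \<open>K > 0\<close>, so equality there has to suffice.\<close>

lemma no_static_arbitrage_cong: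
  assumes "\<And>T K. T > t\<^sub>0 \<Longrightarrow> K > 0 \<Longrightarrow> C T K = C' T K"
  shows "no_static_arbitrage t\<^sub>0 s C \<longleftrightarrow> no_static_arbitrage t\<^sub>0 s C'"
proof -
  have *: "no_static_arbitrage t\<^sub>0 s C'"
    if eq: "\<And>T K. T > t\<^sub>0 \<Longrightarrow> K > 0 \<Longrightarrow> C T K = C' T K" and C: "no_static_arbitrage t\<^sub>0 s C" for C C'
    unfolding no_static_arbitrage_def
  proof (intro conjI allI impI)
    fix T assume T: "t\<^sub>0 < T"
    have "convex_on {0<..} (C T)"
      using T C by (simp add: no_static_arbitrage_def)
    \<comment> \<open>A convex combination of positive strikes is positive, so the prices agree
      there as well.\<close>
    then show "convex_on {0<..} (C' T)"
      using T convexD[of "{0::real<..}"]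
      unfolding convex_on_def by (auto simp flip: eq)
    show "antimono_on {0<..} (C' T)"
      using T C by (auto simp: no_static_arbitrage_def monotone_on_def simp flip: eq)
    show "(C' T \<longlongrightarrow> 0) at_top"
      by (rule Lim_transform_eventually[of "C T"])
        (use T C in \<open>auto simp: no_static_arbitrage_def eq intro!: eventually_mono[OF eventually_gt_at_top[of 0]]\<close>)
    fix K :: real assume K: "0 < K"
    show "max 0 (s - K) \<le> C' T K" "C' T K \<le> s"
      using T C K eq by (auto simp: no_static_arbitrage_def)
  next
    fix K :: real assume K: "0 < K"
    show "((\<lambda>T. C' T K) \<longlongrightarrow> max 0 (s - K)) (at_right t\<^sub>0)"
      by (rule Lim_transform_eventually[of "\<lambda>T. C T K"])
        (use K C in \<open>auto simp: no_static_arbitrage_def eq intro!: eventually_at_rightI[of t\<^sub>0 "t\<^sub>0 + 1"]\<close>)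
    show "mono_on {t\<^sub>0<..} (\<lambda>T. C' T K)"
      using K C by (auto simp: no_static_arbitrage_def monotone_on_def eq[symmetric])
  qed
  show ?thesis using *[of C C'] *[of C' C] assms by auto
qed

text \<open>The free constant in the definition can only be the spot: letting first \<open>T\<close> decrease to
  \<open>t\<^sub>0\<close> and then \<open>K\<close> to \<open>0\<close>, the Black-Scholes bounds force \<open>s = S\<^sub>0\<close>. Hence it is the same for all
  parameters.\<close>

lemma arbitrage_free_iff:
  assumes "S\<^sub>0 > 0" and vol: "vol_surface t\<^sub>0 \<sigma>"
  shows "arbitrage_free t\<^sub>0 S\<^sub>0 r \<sigma> \<longleftrightarrow>
           no_static_arbitrage t\<^sub>0 S\<^sub>0 (\<lambda>T K. BS_call t\<^sub>0 S\<^sub>0 r T K (\<sigma> T K))"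
    (is "_ \<longleftrightarrow> no_static_arbitrage _ _ ?C")
proof
  assume "arbitrage_free t\<^sub>0 S\<^sub>0 r \<sigma>"
  then obtain V s where V: "extended_call_prices t\<^sub>0 S\<^sub>0 r \<sigma> V" and "s > 0"
    and i: "\<forall>T>t\<^sub>0. convex_on {0<..} (V T) \<and> antimono_on {0<..} (V T)"
    and ii: "\<forall>T>t\<^sub>0. (V T \<longlongrightarrow> 0) at_top"
    and iii: "\<forall>T>t\<^sub>0. \<forall>K>0. max 0 (s - K) \<le> V T K \<and> V T K \<le> s"
    and iv: "\<forall>K>0. V t\<^sub>0 K = max 0 (s - K)"
    and v: "\<forall>K>0. mono_on {t\<^sub>0..} (\<lambda>T. V T K)"
    unfolding arbitrage_free_def by (elim exE conjE)
  have eq: "V T K = ?C T K" if "T > t\<^sub>0" "K > 0" for T K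
    using V that by (auto simp: extended_call_prices_def)
  have lim: "((\<lambda>T. V T K) \<longlongrightarrow> max 0 (s - K)) (at_right t\<^sub>0)" if "K > 0" for K
    using V that iv by (auto simp: extended_call_prices_def)
  have bounds: "max 0 (S\<^sub>0 - K * exp (- r * (T - t\<^sub>0))) \<le> V T K" "V T K \<le> S\<^sub>0"
    if "T > t\<^sub>0" "K > 0" for T K
  proof -
    have "V T K \<in> BS_call t\<^sub>0 S\<^sub>0 r T K ` {0..}"
      using vol that by (auto simp: eq vol_surface_def)
    then show "max 0 (S\<^sub>0 - K * exp (- r * (T - t\<^sub>0))) \<le> V T K" "V T K \<le> S\<^sub>0"
      using that assms(1) by (auto simp: BS_call_image)
  qed
  \<comment> \<open>Both price bounds are taken to the limit in \<open>T\<close>, with the strike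
    still free.\<close>
  have le: "s - K \<le> S\<^sub>0" and ge: "S\<^sub>0 - K \<le> max 0 (s - K)" if "K > 0" for K
  proof -
    have "max 0 (s - K) \<le> S\<^sub>0"
      by (rule tendsto_upperbound[OF lim[OF that]])
        (use that bounds in \<open>auto intro!: eventually_at_rightI[of t\<^sub>0 "t\<^sub>0 + 1"]\<close>)
    then show "s - K \<le> S\<^sub>0" by simp
    have "((\<lambda>T. S\<^sub>0 - K * exp (- r * (T - t\<^sub>0))) \<longlongrightarrow> S\<^sub>0 - K * exp (- r * (t\<^sub>0 - t\<^sub>0))) (at_right t\<^sub>0)"
      by (intro tendsto_intros)
    then have "S\<^sub>0 - K * exp (- r * (t\<^sub>0 - t\<^sub>0)) \<le> max 0 (s - K)"
      by (rule tendsto_le[OF _ lim[OF that], rotated])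
        (use that bounds in \<open>auto intro!: eventually_at_rightI[of t\<^sub>0 "t\<^sub>0 + 1"]\<close>)
    then show "S\<^sub>0 - K \<le> max 0 (s - K)" by simp
  qed
  have "s \<le> S\<^sub>0"
  proof (rule field_le_epsilon)
    fix e :: real assume "e > 0"
    from le[OF this] show "s \<le> S\<^sub>0 + e" by simp
  qed
  moreover have "S\<^sub>0 \<le> s"
  proof (rule ccontr)
    assume "\<not> S\<^sub>0 \<le> s"
    \<comment> \<open>With half the gap as strike, the left side is
      \<open>(S\<^sub>0 + s) / 2\<close>, which is positive and exceeds \<open>s\<close> minus the
      strike, hence exceeds the maximum.\<close>
    then have "S\<^sub>0 - (S\<^sub>0 - s) / 2 \<le> max 0 (s - (S\<^sub>0 - s) / 2)"
      by (intro ge) simp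
    with \<open>\<not> S\<^sub>0 \<le> s\<close> \<open>s > 0\<close> show False
      by (simp add: max_def field_simps split: if_splits)
  qed
  ultimately have "s = S\<^sub>0" by simp
  have "no_static_arbitrage t\<^sub>0 S\<^sub>0 V"
    using i ii iii lim v unfolding no_static_arbitrage_def \<open>s = S\<^sub>0\<close>
    by (auto elim!: monotone_on_subset)
  then show "no_static_arbitrage t\<^sub>0 S\<^sub>0 ?C"
    using no_static_arbitrage_cong[OF eq] by simp
next
  assume C: "no_static_arbitrage t\<^sub>0 S\<^sub>0 ?C"
  define V where "V T K = (if T = t\<^sub>0 then max 0 (S\<^sub>0 - K) else ?C T K)" for T K
  have V_gt: "V T = ?C T" if "T > t\<^sub>0" for T
    using that by (auto simp: V_def)
  have "((\<lambda>T. V T K) \<longlongrightarrow> V t\<^sub>0 K) (at_right t\<^sub>0)" if "K > 0" for K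
  proof (rule Lim_transform_eventually)
    show "((\<lambda>T. ?C T K) \<longlongrightarrow> V t\<^sub>0 K) (at_right t\<^sub>0)"
      using C that by (simp add: no_static_arbitrage_def V_def)
    show "\<forall>\<^sub>F T in at_right t\<^sub>0. ?C T K = V T K"
      by (rule eventually_at_rightI[of t\<^sub>0 "t\<^sub>0 + 1"]) (auto simp: V_gt)
  qed
  then have "extended_call_prices t\<^sub>0 S\<^sub>0 r \<sigma> V"
    by (auto simp: extended_call_prices_def V_gt)
  \<comment> \<open>Starting from \<open>t\<^sub>0\<close>, monotonicity is the lower price bound at
    the later expiry.\<close>
  moreover have "mono_on {t\<^sub>0..} (\<lambda>T. V T K)" if "K > 0" for K
  proof (rule mono_onI)
    fix T U assume "T \<in> {t\<^sub>0..}" "U \<in> {t\<^sub>0..}" "T \<le> U"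
    with C that show "V T K \<le> V U K"
      by (auto simp: V_def no_static_arbitrage_def monotone_on_def)
  qed
  ultimately show "arbitrage_free t\<^sub>0 S\<^sub>0 r \<sigma>"
    unfolding arbitrage_free_def using C \<open>S\<^sub>0 > 0\<close>
    by (intro exI[of _ V] conjI exI[of _ S\<^sub>0])
      (auto simp: V_gt no_static_arbitrage_def, simp_all add: V_def)
qed

section \<open>Averaging over a probability space\<close>

text \<open>The constant \<open>s\<close> is common to all outcomes: it dominates every integrand,
  and the payoff limit at \<open>t\<^sub>0\<close> is the same for each outcome.\<close>

lemma (in prob_space) no_static_arbitrage_expectation:
  assumes C: "\<And>\<omega>. \<omega> \<in> space M \<Longrightarrow> no_static_arbitrage t\<^sub>0 s (C \<omega>)"
    and meas: "\<And>T K. T > t\<^sub>0 \<Longrightarrow> K > 0 \<Longrightarrow> (\<lambda>\<omega>. C \<omega> T K) \<in> borel_measurable M"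
  shows "no_static_arbitrage t\<^sub>0 s (\<lambda>T K. expectation (\<lambda>\<omega>. C \<omega> T K))"
proof -
  have bounds: "max 0 (s - K) \<le> C \<omega> T K" "C \<omega> T K \<le> s"
    if "\<omega> \<in> space M" "T > t\<^sub>0" "K > 0" for \<omega> T K
    using C that by (auto simp: no_static_arbitrage_def)
  have norm: "\<bar>C \<omega> T K\<bar> \<le> s" if "\<omega> \<in> space M" "T > t\<^sub>0" "K > 0" for \<omega> T K
    using bounds[OF that] by simp
  have int: "integrable M (\<lambda>\<omega>. C \<omega> T K)" if "T > t\<^sub>0" "K > 0" for T K
    using that by (intro integrable_const_bound[where B=s] meas AE_I2) (simp add: norm)
  show ?thesis
    unfolding no_static_arbitrage_def
  proof (intro conjI allI impI)
    fix T assume T: "t\<^sub>0 < T"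
    show "convex_on {0<..} (\<lambda>K. expectation (\<lambda>\<omega>. C \<omega> T K))"
    proof (rule convex_onI)
      fix u x y :: real assume *: "0 < u" "u < 1" "x \<in> {0<..}" "y \<in> {0<..}"
      have "C \<omega> T ((1 - u) * x + u * y) \<le> (1 - u) * C \<omega> T x + u * C \<omega> T y" if "\<omega> \<in> space M" for \<omega>
        using convex_onD[of "{0<..}" "C \<omega> T" u x y] C[OF that] T *
        by (simp add: no_static_arbitrage_def)
      moreover
      have "(1 - u) * x + u * y > 0"
        using * by (intro add_pos_pos) auto
      ultimately have "expectation (\<lambda>\<omega>. C \<omega> T ((1 - u) * x + u * y)) \<le>
          expectation (\<lambda>\<omega>. (1 - u) * C \<omega> T x + u * C \<omega> T y)"
        using * T by (intro integral_mono int Bochner_Integration.integrable_add integrable_mult_right) auto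
      also have "\<dots> = (1 - u) * expectation (\<lambda>\<omega>. C \<omega> T x) + u * expectation (\<lambda>\<omega>. C \<omega> T y)"
        using * T by (subst Bochner_Integration.integral_add) (auto intro!: int)
      finally show "expectation (\<lambda>\<omega>. C \<omega> T ((1 - u) *\<^sub>R x + u *\<^sub>R y)) \<le>
          (1 - u) * expectation (\<lambda>\<omega>. C \<omega> T x) + u * expectation (\<lambda>\<omega>. C \<omega> T y)"
        by simp
    qed simp
    show "antimono_on {0<..} (\<lambda>K. expectation (\<lambda>\<omega>. C \<omega> T K))"
      using T C by (intro monotone_onI integral_mono int)
        (auto simp: no_static_arbitrage_def monotone_on_def)
    show "((\<lambda>K. expectation (\<lambda>\<omega>. C \<omega> T K)) \<longlongrightarrow> 0) at_top"
    proof (rule tendsto_at_topI_sequentially)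
      fix X :: "nat \<Rightarrow> real" assume X: "filterlim X at_top sequentially"
      then have "\<forall>\<^sub>F n in sequentially. X n > 0"
        by (auto simp: filterlim_at_top_dense)
      \<comment> \<open>Dominated convergence is applied along a sequence of strikes; the shift by
        \<open>N\<close> keeps all of them positive, where bounds and measurability are
        available.\<close>
      then obtain N where N: "\<And>n. n \<ge> N \<Longrightarrow> X n > 0"
        by (auto simp: eventually_sequentially)
      have lim: "(\<lambda>n. expectation (\<lambda>\<omega>. C \<omega> T (X (n + N)))) \<longlonglongrightarrow> expectation (\<lambda>\<omega>. 0)"
      proof (rule integral_dominated_convergence[where w="\<lambda>_. s"])
        show "AE \<omega> in M. (\<lambda>n. C \<omega> T (X (n + N))) \<longlonglongrightarrow> 0"
          using T C by (intro AE_I2 LIMSEQ_ignore_initial_segment filterlim_compose[OF _ X])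
            (auto simp: no_static_arbitrage_def)
      qed (use T N in \<open>auto intro!: meas AE_I2 norm\<close>)
      show "(\<lambda>n. expectation (\<lambda>\<omega>. C \<omega> T (X n))) \<longlonglongrightarrow> 0"
        by (rule LIMSEQ_offset[of _ N]) (use lim in simp)
    qed
    fix K :: real assume K: "0 < K"
    \<comment> \<open>Without \<open>max.bounded_iff\<close> the maximum stays a single constant, as
      \<open>integral_ge_const\<close> expects.\<close>
    show "max 0 (s - K) \<le> expectation (\<lambda>\<omega>. C \<omega> T K)" "expectation (\<lambda>\<omega>. C \<omega> T K) \<le> s"
      using T K by (auto intro!: integral_ge_const integral_le_const int AE_I2 bounds simp del: max.bounded_iff)
  next
    fix K :: real assume K: "0 < K"
    show "((\<lambda>T. expectation (\<lambda>\<omega>. C \<omega> T K)) \<longlongrightarrow> max 0 (s - K)) (at_right t\<^sub>0)"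
      unfolding tendsto_at_iff_sequentially comp_def
    proof (intro allI impI)
      fix X :: "nat \<Rightarrow> real" assume X: "\<forall>n. X n \<in> {t\<^sub>0<..} - {t\<^sub>0}" "X \<longlonglongrightarrow> t\<^sub>0"
      have "(\<lambda>n. expectation (\<lambda>\<omega>. C \<omega> (X n) K)) \<longlonglongrightarrow> expectation (\<lambda>\<omega>. max 0 (s - K))"
      proof (rule integral_dominated_convergence[where w="\<lambda>_. s"])
        show "AE \<omega> in M. (\<lambda>n. C \<omega> (X n) K) \<longlonglongrightarrow> max 0 (s - K)"
          using X K C by (intro AE_I2)
            (auto simp: no_static_arbitrage_def tendsto_at_iff_sequentially comp_def)
      qed (use K X in \<open>auto intro!: meas AE_I2 norm\<close>)
      then show "(\<lambda>n. expectation (\<lambda>\<omega>. C \<omega> (X n) K)) \<longlonglongrightarrow> max 0 (s - K)"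
        by (simp add: prob_space)
    qed
    show "mono_on {t\<^sub>0<..} (\<lambda>T. expectation (\<lambda>\<omega>. C \<omega> T K))"
      using K C by (intro monotone_onI integral_mono int)
        (auto simp: no_static_arbitrage_def monotone_on_def)
  qed
qed

section \<open>The mixture surface\<close>

text \<open>The integrability clause ensures that the expectations are genuine and not the default
  value 0 of the integral. Uniqueness expresses that the prices determine the surface.\<close>

theorem lemma2p2:
  fixes t\<^sub>0 S\<^sub>0 r :: real
    and D :: "(real ^ 'm::finite) set"
    and \<sigma> :: "real \<Rightarrow> real \<Rightarrow> real ^ 'm \<Rightarrow> real"
    and p :: "real ^ 'm" and i :: 'm
    and M :: "'w measure" and \<theta> :: "'w \<Rightarrow> real"
  assumes "S\<^sub>0 > 0"
    and "parametrized_vol t\<^sub>0 D \<sigma>"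
    and "\<And>q. q \<in> D \<Longrightarrow> arbitrage_free t\<^sub>0 S\<^sub>0 r (\<lambda>T K. \<sigma> T K q)"
    and "prob_space M"
    and "\<theta> \<in> borel_measurable M"
    and "AE \<omega> in M. replace_entry p i (\<theta> \<omega>) \<in> D"
    and "\<And>T K. T > t\<^sub>0 \<Longrightarrow> K > 0 \<Longrightarrow>
           (\<lambda>x. \<sigma> T K (replace_entry p i x))
             \<in> borel_measurable (restrict_space borel {x. replace_entry p i x \<in> D})"
  defines "P \<equiv> \<lambda>\<omega>. replace_entry p i (\<theta> \<omega>)"
  shows "(\<forall>T>t\<^sub>0. \<forall>K>0.
            as_integrable M {\<omega> \<in> space M. P \<omega> \<in> D} (\<lambda>\<omega>. V_call t\<^sub>0 S\<^sub>0 r \<sigma> T K (P \<omega>)) \<and>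
            as_integrable M {\<omega> \<in> space M. P \<omega> \<in> D} (\<lambda>\<omega>. V_put t\<^sub>0 S\<^sub>0 r \<sigma> T K (P \<omega>))) \<and>
         (\<exists>\<sigma>'. vol_surface t\<^sub>0 \<sigma>' \<and> mixture_vol t\<^sub>0 S\<^sub>0 r D \<sigma> M P \<sigma>' \<and>
            arbitrage_free t\<^sub>0 S\<^sub>0 r \<sigma>' \<and>
            (\<forall>\<tau>. vol_surface t\<^sub>0 \<tau> \<and> mixture_vol t\<^sub>0 S\<^sub>0 r D \<sigma> M P \<tau> \<longrightarrow>
               (\<forall>T>t\<^sub>0. \<forall>K>0. \<tau> T K = \<sigma>' T K)))"
proof -
  interpret prob_space M by fact
  interpret N: prob_space "completion M" by (rule prob_space_completion)
  define A where "A = {\<omega> \<in> space M. P \<omega> \<in> D}"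
  \<comment> \<open>On \<open>Q\<close> the parameter lies in \<open>D\<close> at every point, so
    almost sure hypotheses become pointwise ones.\<close>
  define Q where "Q = restrict_space (completion M) A"
  have AE: "AE \<omega> in completion M. \<omega> \<in> A"
    using assms(6) by (intro AE_completion) (auto simp: A_def P_def)
  \<comment> \<open>The complement of \<open>A\<close> is contained in a null set of
    \<open>M\<close>, hence measurable in the completion.\<close>
  have A: "A \<in> sets (completion M)"
  proof -
    have "AE \<omega> in M. \<not> \<omega> \<notin> A"
      using assms(6) by (auto simp: A_def P_def)
    then have "Measurable.pred (completion M) (\<lambda>\<omega>. \<omega> \<notin> A)"
      by (rule sets_completion_AE)
    then have "{\<omega> \<in> space (completion M). \<not> \<omega> \<notin> A} \<in> sets (completion M)"
      by measurable
    also have "{\<omega> \<in> space (completion M). \<not> \<omega> \<notin> A} = A"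
      by (auto simp: A_def)
    finally show ?thesis .
  qed
  have space_Q: "space Q = A"
    by (auto simp: Q_def space_restrict_space A_def)
  interpret Q: prob_space Q
    unfolding Q_def using A AE by (intro prob_space_restrict_space N.emeasure_eq_1_AE)
  have as_integrable: "as_integrable M A X \<longleftrightarrow> integrable Q X"
    and as_expectation: "as_expectation M A X = Q.expectation X" for X
    using A sets.Int_space_eq2[OF A]
    unfolding as_integrable_def as_expectation_def Q_def set_integrable_def set_lebesgue_integral_def
    by (simp_all add: integrable_restrict_space integral_restrict_space)
  have vol: "vol_surface t\<^sub>0 (\<lambda>T K. \<sigma> T K (P \<omega>))"
    and arb: "no_static_arbitrage t\<^sub>0 S\<^sub>0 (\<lambda>T K. V_call t\<^sub>0 S\<^sub>0 r \<sigma> T K (P \<omega>))" if "\<omega> \<in> A" for \<omega>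
  proof -
    show vol: "vol_surface t\<^sub>0 (\<lambda>T K. \<sigma> T K (P \<omega>))"
      using assms(2) that by (auto simp: A_def parametrized_vol_def)
    show "no_static_arbitrage t\<^sub>0 S\<^sub>0 (\<lambda>T K. V_call t\<^sub>0 S\<^sub>0 r \<sigma> T K (P \<omega>))"
      using assms(3)[of "P \<omega>"] that unfolding V_call_def arbitrage_free_iff[OF assms(1) vol]
      by (auto simp: A_def)
  qed
  have vol_nonneg: "0 \<le> \<sigma> T K (P \<omega>)" if "T > t\<^sub>0" "K > 0" "\<omega> \<in> A" for T K \<omega>
    using vol that by (auto simp: vol_surface_def)
  have meas: "(\<lambda>\<omega>. V_call t\<^sub>0 S\<^sub>0 r \<sigma> T K (P \<omega>)) \<in> borel_measurable Q" if "T > t\<^sub>0" "K > 0" for T K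
    unfolding V_call_def
  proof (rule borel_measurable_BS_call[OF assms(1) that])
    have "\<theta> \<in> Q \<rightarrow>\<^sub>M restrict_space borel {x. replace_entry p i x \<in> D}"
      unfolding Q_def using assms(5)
      by (intro measurable_restrict_space3 measurable_completion) (auto simp: A_def P_def)
    then show "(\<lambda>\<omega>. \<sigma> T K (P \<omega>)) \<in> borel_measurable Q"
      unfolding P_def by (rule measurable_compose) (rule assms(7)[OF that])
  qed (use vol_nonneg that in \<open>simp add: space_Q\<close>)
  have bounds: "max 0 (S\<^sub>0 - K * exp (- r * (T - t\<^sub>0))) \<le> V_call t\<^sub>0 S\<^sub>0 r \<sigma> T K (P \<omega>)"
    "V_call t\<^sub>0 S\<^sub>0 r \<sigma> T K (P \<omega>) < S\<^sub>0" if "T > t\<^sub>0" "K > 0" "\<omega> \<in> A" for T K \<omega>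
  proof -
    have "V_call t\<^sub>0 S\<^sub>0 r \<sigma> T K (P \<omega>) \<in> BS_call t\<^sub>0 S\<^sub>0 r T K ` {0..}"
      using vol_nonneg[OF that] by (simp add: V_call_def)
    then show "max 0 (S\<^sub>0 - K * exp (- r * (T - t\<^sub>0))) \<le> V_call t\<^sub>0 S\<^sub>0 r \<sigma> T K (P \<omega>)"
      "V_call t\<^sub>0 S\<^sub>0 r \<sigma> T K (P \<omega>) < S\<^sub>0"
      unfolding BS_call_image[OF assms(1) that(1,2)] by auto
  qed
  have int: "integrable Q (\<lambda>\<omega>. V_call t\<^sub>0 S\<^sub>0 r \<sigma> T K (P \<omega>))" if "T > t\<^sub>0" "K > 0" for T K
    using bounds[OF that] meas[OF that]
    by (intro Q.integrable_const_bound[where B=S\<^sub>0] AE_I2) (auto simp: space_Q less_imp_le)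
  have put: "V_put t\<^sub>0 S\<^sub>0 r \<sigma> T K (P \<omega>) =
      V_call t\<^sub>0 S\<^sub>0 r \<sigma> T K (P \<omega>) + (K * exp (- r * (T - t\<^sub>0)) - S\<^sub>0)"
    if "T > t\<^sub>0" "K > 0" "\<omega> \<in> space Q" for T K \<omega>
    unfolding V_put_def V_call_def
    using that vol_nonneg by (intro put_call_parity assms(1)) (auto simp: space_Q)
  have int_put: "integrable Q (\<lambda>\<omega>. V_put t\<^sub>0 S\<^sub>0 r \<sigma> T K (P \<omega>))"
    and expectation_put: "Q.expectation (\<lambda>\<omega>. V_put t\<^sub>0 S\<^sub>0 r \<sigma> T K (P \<omega>)) =
      Q.expectation (\<lambda>\<omega>. V_call t\<^sub>0 S\<^sub>0 r \<sigma> T K (P \<omega>)) + (K * exp (- r * (T - t\<^sub>0)) - S\<^sub>0)"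
    if "T > t\<^sub>0" "K > 0" for T K
  proof -
    show "integrable Q (\<lambda>\<omega>. V_put t\<^sub>0 S\<^sub>0 r \<sigma> T K (P \<omega>))"
      using int[OF that] by (subst Bochner_Integration.integrable_cong[OF refl put[OF that]]) auto
    show "Q.expectation (\<lambda>\<omega>. V_put t\<^sub>0 S\<^sub>0 r \<sigma> T K (P \<omega>)) =
      Q.expectation (\<lambda>\<omega>. V_call t\<^sub>0 S\<^sub>0 r \<sigma> T K (P \<omega>)) + (K * exp (- r * (T - t\<^sub>0)) - S\<^sub>0)"
      using int[OF that]
      by (subst Bochner_Integration.integral_cong[OF refl put[OF that]]) (auto simp: Q.prob_space)
  qed
  define E where "E T K = Q.expectation (\<lambda>\<omega>. V_call t\<^sub>0 S\<^sub>0 r \<sigma> T K (P \<omega>))" for T K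
  \<comment> \<open>By parity both sides of the put equation are the call sides shifted by the same
    constant.\<close>
  have mixture_iff: "mixture_vol t\<^sub>0 S\<^sub>0 r D \<sigma> M P \<tau> \<longleftrightarrow>
      (\<forall>T>t\<^sub>0. \<forall>K>0. BS_call t\<^sub>0 S\<^sub>0 r T K (\<tau> T K) = E T K)" if "vol_surface t\<^sub>0 \<tau>" for \<tau>
    unfolding mixture_vol_def A_def[symmetric] as_expectation E_def
    using that by (auto simp: expectation_put put_call_parity[OF assms(1)] vol_surface_def)
  \<comment> \<open>The upper bound must stay strict under averaging, since the price
    \<open>S\<^sub>0\<close> has no implied volatility; \<open>expectation_less\<close> provides
    this.\<close>
  have "E T K \<in> BS_call t\<^sub>0 S\<^sub>0 r T K ` {0..}" if "T > t\<^sub>0" "K > 0" for T K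
    unfolding BS_call_image[OF assms(1) that] E_def
    using bounds[OF that] int[OF that]
    by (auto simp: space_Q simp del: max.bounded_iff
      intro!: Q.integral_ge_const Q.expectation_less AE_I2)
  then have "\<exists>v\<ge>0. BS_call t\<^sub>0 S\<^sub>0 r T K v = E T K" if "T > t\<^sub>0" "K > 0" for T K
    using that by force
  then obtain \<sigma>' where "\<And>T K. T > t\<^sub>0 \<Longrightarrow> K > 0 \<Longrightarrow> \<sigma>' T K \<ge> 0 \<and> BS_call t\<^sub>0 S\<^sub>0 r T K (\<sigma>' T K) = E T K"
    by metis
  then have vol': "vol_surface t\<^sub>0 \<sigma>'"
    and eq: "\<And>T K. T > t\<^sub>0 \<Longrightarrow> K > 0 \<Longrightarrow> BS_call t\<^sub>0 S\<^sub>0 r T K (\<sigma>' T K) = E T K"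
    by (auto simp: vol_surface_def)
  have "no_static_arbitrage t\<^sub>0 S\<^sub>0 E"
    unfolding E_def by (intro Q.no_static_arbitrage_expectation arb meas) (simp_all add: space_Q)
  then have "arbitrage_free t\<^sub>0 S\<^sub>0 r \<sigma>'"
    unfolding arbitrage_free_iff[OF assms(1) vol']
    using no_static_arbitrage_cong[OF eq, where s=S\<^sub>0] by simp
  moreover have "\<tau> T K = \<sigma>' T K"
    if \<tau>: "vol_surface t\<^sub>0 \<tau>" "mixture_vol t\<^sub>0 S\<^sub>0 r D \<sigma> M P \<tau>" and TK: "T > t\<^sub>0" "K > 0" for \<tau> T K
  proof -
    have "inj_on (BS_call t\<^sub>0 S\<^sub>0 r T K) {0..}"
      using BS_call_strict_mono_on[OF assms(1) TK] by (rule strict_mono_on_imp_inj_on)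
    then show ?thesis
      by (rule inj_onD) (use \<tau> TK vol' eq[OF TK] in \<open>auto simp: mixture_iff vol_surface_def\<close>)
  qed
  moreover have "mixture_vol t\<^sub>0 S\<^sub>0 r D \<sigma> M P \<sigma>'"
    using eq by (simp add: mixture_iff[OF vol'])
  ultimately show ?thesis
    using vol' int int_put unfolding A_def[symmetric] as_integrable by blast
qed

end
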